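(* Let $G$ be an interval colorable graph. Then for every integer $n\ge 2$, $G[C_{2n}]$ is interval colorable, and $$w(G[C_{2n}])\le 2(w(G)\cdot n+1)\quad\text{and}\quad W(G[C_{2n}])\ge (2\,W(G)+1)n+1.$$
   Context: All graphs are finite, undirected, without loops or multiple edges. $C_{2n}$ is the cycle on $2n$ vertices. A proper edge-coloring with consecutive integers $c_1,\ldots,c_t$ is an interval $t$-coloring if all $t$ colors are used and the set of colors on edges incident to each vertex is an interval of integers. A graph is interval colorable if it has an interval $t$-coloring for some positive integer $t$; $w(G)$ and $W(G)$ denote the smallest and largest such $t$. The composition $G[H]$ has vertex set $V(G)\times V(H)$, with $(u_1,v_1)(u_2,v_2)$ an edge iff $u_1u_2\in E(G)$, or $u_1=u_2$ and $v_1v_2\in E(H)$. *)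

theory Defs
  imports Main
begin

datatype 'a ugraph = UGraph (verts: "'a set") (edges: "'a set set")

definition simple_graph :: "'a ugraph \<Rightarrow> bool" where
  "simple_graph G \<longleftrightarrow>
     finite (verts G) \<and> (\<forall>e\<in>edges G. e \<subseteq> verts G \<and> card e = 2)"

text \<open>This is the usual cycle graph only for \<open>m \<ge> 3\<close>.\<close>

definition cycle_graph :: "nat \<Rightarrow> nat ugraph" where
  "cycle_graph m = UGraph {0..<m} {{i, (i + 1) mod m} | i. i < m}"

definition composition :: "'a ugraph \<Rightarrow> 'b ugraph \<Rightarrow> ('a \<times> 'b) ugraph" where
  "composition G H = UGraph (verts G \<times> verts H)
     {{(u1, v1), (u2, v2)} | u1 v1 u2 v2.
        u1 \<in> verts G \<and> v1 \<in> verts H \<and> u2 \<in> verts G \<and> v2 \<in> verts H \<and>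
        ({u1, u2} \<in> edges G \<or> (u1 = u2 \<and> {v1, v2} \<in> edges H))}"

definition incident_edges :: "'a ugraph \<Rightarrow> 'a \<Rightarrow> 'a set set" where
  "incident_edges G v = {e \<in> edges G. v \<in> e}"

definition proper_edge_coloring :: "'a ugraph \<Rightarrow> ('a set \<Rightarrow> int) \<Rightarrow> bool" where
  "proper_edge_coloring G f \<longleftrightarrow>
     (\<forall>e\<in>edges G. \<forall>e'\<in>edges G. e \<noteq> e' \<and> e \<inter> e' \<noteq> {} \<longrightarrow> f e \<noteq> f e')"

text \<open>
  The empty set counts as an interval (take \<open>b < a\<close>), so an isolated vertex
  imposes no condition on a coloring.
\<close>

definition integer_interval :: "int set \<Rightarrow> bool" where
  "integer_interval S \<longleftrightarrow> (\<exists>a b. S = {a..b})"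

text \<open>
  The colors are \<open>t\<close> consecutive integers starting anywhere, not necessarily at \<open>1\<close>.
  Equality of the image with the color set says that all \<open>t\<close> colors are used.
\<close>

definition interval_t_coloring :: "'a ugraph \<Rightarrow> nat \<Rightarrow> ('a set \<Rightarrow> int) \<Rightarrow> bool" where
  "interval_t_coloring G t f \<longleftrightarrow>
     proper_edge_coloring G f \<and>
     (\<exists>c. f ` edges G = {c..<c + int t}) \<and>
     (\<forall>v\<in>verts G. integer_interval (f ` incident_edges G v))"

definition interval_color_numbers :: "'a ugraph \<Rightarrow> nat set" where
  "interval_color_numbers G = {t. 0 < t \<and> (\<exists>f. interval_t_coloring G t f)}"

definition interval_colorable :: "'a ugraph \<Rightarrow> bool" where
  "interval_colorable G \<longleftrightarrow> interval_color_numbers G \<noteq> {}"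

lemma interval_color_numbers_le_card_edges:
  assumes "finite (edges G)" "t \<in> interval_color_numbers G"
  shows "t \<le> card (edges G)"
proof -
  obtain f c where "f ` edges G = {c..<c + int t}"
    using assms(2) by (auto simp: interval_color_numbers_def interval_t_coloring_def)
  then have "t = card (f ` edges G)" by simp
  then show ?thesis using card_image_le[OF assms(1), of f] by simp
qed

lemma finite_edges: "simple_graph G \<Longrightarrow> finite (edges G)"
  unfolding simple_graph_def by (meson Pow_iff finite_Pow_iff finite_subset subsetI)

lemma finite_interval_color_numbers:
  "simple_graph G \<Longrightarrow> finite (interval_color_numbers G)"
  using interval_color_numbers_le_card_edges[OF finite_edges]
  by (meson finite_nat_set_iff_bounded_le)

text \<open>
  For an interval colorable simple graph the set of possible color numbers is
  nonempty and finite, so its minimum and maximum are meaningful.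
\<close>

definition w_min :: "'a ugraph \<Rightarrow> nat" where
  "w_min G = Min (interval_color_numbers G)"

definition W_max :: "'a ugraph \<Rightarrow> nat" where
  "W_max G = Max (interval_color_numbers G)"

lemma simple_graph_cycle_graph:
  assumes "2 \<le> m"
  shows "simple_graph (cycle_graph m)"
proof -
  have "(i + 1) mod m \<noteq> i" if "i < m" for i
    using assms that by (cases "i + 1 = m") auto
  then show ?thesis
    using assms by (fastforce simp: simple_graph_def cycle_graph_def card_2_iff)
qed

lemma simple_graph_composition:
  assumes "simple_graph G" "simple_graph H"
  shows "simple_graph (composition G H)"
proof -
  have "x \<noteq> y" if "{x, y} \<in> edges G" for x y
    using that assms(1) by (force simp: simple_graph_def)
  moreover have "x \<noteq> y" if "{x, y} \<in> edges H" for x y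
    using that assms(2) by (force simp: simple_graph_def)
  ultimately show ?thesis
    using assms by (fastforce simp: simple_graph_def composition_def card_2_iff)
qed

end

theory Submission imports Defs begin

text \<open>Start from an interval \<open>t\<close>-coloring \<open>f\<close> of \<open>G\<close>
  with colors \<open>0..<t\<close> and put \<open>m = 2 * n\<close>. The edges of
  \<open>composition G H\<close> over one edge of \<open>G\<close> form a complete bipartite graph,
  so an edge of color \<open>k\<close> is blown up to a block of \<open>m\<close> colors near
  \<open>m * k\<close>, distributed by a symmetric array \<open>Q\<close> on the vertices of the
  cycle. If \<open>u\<close> sees the colors \<open>{a..<T}\<close> in \<open>G\<close>, the cross
  edges at \<open>(u, x)\<close> see \<open>{m * a + d x..<m * T + d x}\<close>; the cycle over
  \<open>u\<close>, colored by \<open>p\<close> shifted by \<open>m * T\<close>, contributes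
  \<open>m * T + d x\<close> and \<open>m * T + d x + 1\<close>. The two runs abut, so the spectrum
  is an interval. If \<open>p\<close> uses \<open>s\<close> colors, \<open>m * t + s\<close> colors
  are used altogether (\<open>interval_t_coloring_composition\<close>).

  It remains to choose \<open>p\<close>, \<open>Q\<close> and \<open>d\<close>, where row
  \<open>x\<close> of \<open>Q\<close> must fill the \<open>m\<close> colors from \<open>d x\<close>
  on. Alternating the colors 0 and 1 around the cycle gives \<open>d = 0\<close> and
  \<open>s = 2\<close>, with a cyclic Latin square for \<open>Q\<close>. Letting the colors climb
  along both halves of the cycle gives \<open>s = n + 1\<close>. Taking \<open>t\<close> minimal in
  the first case and maximal in the second yields the two bounds.\<close>

section \<open>Normalized colorings and blocks of colors\<close>

lemma proper_edge_coloring_iff_inj_on: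
  "proper_edge_coloring G f \<longleftrightarrow> (\<forall>v. inj_on f (incident_edges G v))"
  unfolding proper_edge_coloring_def incident_edges_def inj_on_def by blast

lemma interval_t_coloring_shift:
  assumes "interval_t_coloring G t f"
  obtains g where "interval_t_coloring G t g" "g ` edges G = {0..<int t}"
proof -
  obtain c where c: "f ` edges G = {c..<c + int t}"
    using assms by (auto simp: interval_t_coloring_def)
  define g where "g = (\<lambda>e. f e - c)"
  have img: "g ` S = (\<lambda>z. z - c) ` (f ` S)" for S
    by (auto simp: g_def)
  have im: "g ` edges G = {0..<int t}"
    unfolding img c by (auto intro!: image_eqI[of _ _ "_ + c"])
  moreover have "\<exists>c. g ` edges G = {c..<c + int t}"
    using im by (intro exI[of _ 0]) simp
  moreover have "integer_interval (g ` incident_edges G v)" if v: "v \<in> verts G" for v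
  proof -
    obtain a b where "f ` incident_edges G v = {a..b}"
      using assms v unfolding interval_t_coloring_def integer_interval_def by blast
    then show ?thesis
      unfolding integer_interval_def img by auto
  qed
  ultimately have "interval_t_coloring G t g"
    using assms by (auto simp: interval_t_coloring_def proper_edge_coloring_def g_def)
  with im show thesis by (rule that[rotated])
qed

text \<open>Division of \<open>c - d\<close> by \<open>m\<close>: quotients name blocks of
  \<open>m\<close> consecutive integers, remainders the places in them, and consecutive blocks abut.
  The offset \<open>d\<close> leaves room for a shift depending on the vertex.\<close>

lemma block_image:
  fixes m :: int
  assumes "0 < m"
  shows "(\<lambda>(k, z). m * k + z) ` ({a..<b} \<times> {d..<d + m}) = {m * a + d..<m * b + d}"
proof (intro equalityI subsetI)
  fix c assume "c \<in> (\<lambda>(k, z). m * k + z) ` ({a..<b} \<times> {d..<d + m})"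
  then obtain k z where *: "c = m * k + z" "a \<le> k" "k + 1 \<le> b" "d \<le> z" "z < d + m"
    by auto
  have "m * a \<le> m * k" "m * (k + 1) \<le> m * b"
    using * assms by (intro mult_left_mono; simp)+
  then have "m * a + d \<le> c" "c < m * b + d"
    using * unfolding distrib_left by linarith+
  then show "c \<in> {m * a + d..<m * b + d}" by simp
next
  fix c assume c: "c \<in> {m * a + d..<m * b + d}"
  have dm: "m * ((c - d) div m) + (c - d) mod m = c - d" by simp
  have r: "0 \<le> (c - d) mod m" "(c - d) mod m < m"
    using assms by simp_all
  have "m * a < m * ((c - d) div m + 1)" "m * ((c - d) div m) < m * b"
    using c dm r unfolding distrib_left atLeastLessThan_iff by linarith+
  then have "a < (c - d) div m + 1" "(c - d) div m < b"
    unfolding mult_less_cancel_left_pos[OF assms] by simp_all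
  then show "c \<in> (\<lambda>(k, z). m * k + z) ` ({a..<b} \<times> {d..<d + m})"
    using dm r by (intro image_eqI[of _ _ "((c - d) div m, d + (c - d) mod m)"]) auto
qed

lemma block_unique:
  fixes m :: int
  assumes "m * k + z = m * k' + z'" "z \<in> {d..<d + m}" "z' \<in> {d..<d + m}"
  shows "k = k' \<and> z = z'"
proof -
  have "m * k + (z - d) = m * k' + (z' - d)" using assms by simp
  moreover have "(m * k + (z - d)) div m = k" "(m * k' + (z' - d)) div m = k'"
    using assms by (simp_all add: div_pos_pos_trivial)
  ultimately have "k = k'" by metis
  with assms show ?thesis by simp
qed

section \<open>Incident edges and color sets\<close>

lemma incident_edges_composition:
  assumes "simple_graph G" "simple_graph H" "u \<in> verts G" "x \<in> verts H"
  shows "incident_edges (composition G H) (u, x) =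
    (\<lambda>(v, y). {(u, x), (v, y)}) ` ({v. {u, v} \<in> edges G} \<times> verts H) \<union>
    (\<lambda>y. {(u, x), (u, y)}) ` {y. {x, y} \<in> edges H}" (is "?I = ?A \<union> ?B")
proof (intro equalityI subsetI)
  fix e assume "e \<in> ?I"
  then obtain u1 v1 u2 v2 where e: "e = {(u1, v1), (u2, v2)}" "(u, x) \<in> e"
    and v: "v1 \<in> verts H" "v2 \<in> verts H"
    and adj: "{u1, u2} \<in> edges G \<or> (u1 = u2 \<and> {v1, v2} \<in> edges H)"
    by (auto simp: incident_edges_def composition_def)
  have "\<exists>v y. y \<in> verts H \<and> e = {(u, x), (v, y)} \<and>
      ({u, v} \<in> edges G \<or> (u = v \<and> {x, y} \<in> edges H))"
  proof (cases "(u, x) = (u1, v1)")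
    case True
    then show ?thesis using e v adj by blast
  next
    case False
    then have "u2 = u" "v2 = x" using e by auto
    then show ?thesis
      using e v adj by (intro exI[of _ u1] exI[of _ v1]) (auto simp: insert_commute)
  qed
  then show "e \<in> ?A \<union> ?B" by auto
next
  have G: "v \<in> verts G" if "{u, v} \<in> edges G" for v
    using that assms(1) by (auto simp: simple_graph_def)
  have H: "y \<in> verts H" if "{x, y} \<in> edges H" for y
    using that assms(2) by (auto simp: simple_graph_def)
  fix e assume "e \<in> ?A \<union> ?B"
  then obtain v y where "e = {(u, x), (v, y)}" "y \<in> verts H" "v \<in> verts G"
      "{u, v} \<in> edges G \<or> (u = v \<and> {x, y} \<in> edges H)"
    using G H assms by auto
  then show "e \<in> ?I"
    using assms by (auto simp: incident_edges_def composition_def)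
qed

lemma incident_edges_eq_neighbours:
  assumes "simple_graph G"
  shows "incident_edges G u = (\<lambda>v. {u, v}) ` {v. {u, v} \<in> edges G}"
proof -
  have "\<exists>v. e = {u, v}" if "e \<in> edges G" "u \<in> e" for e
    using that assms by (auto simp: simple_graph_def card_2_iff insert_commute)
  then show ?thesis by (fastforce simp: incident_edges_def)
qed

lemma not_loop: "simple_graph G \<Longrightarrow> {u, u} \<notin> edges G"
  by (auto simp: simple_graph_def)

lemma Union_incident_edges:
  assumes "simple_graph G"
  shows "edges G = (\<Union>v\<in>verts G. incident_edges G v)"
proof -
  have "\<exists>v\<in>verts G. v \<in> e" if "e \<in> edges G" for e
    using that assms by (fastforce simp: simple_graph_def card_2_iff)
  then show ?thesis by (auto simp: incident_edges_def)
qed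

lemma image_edges:
  assumes "simple_graph G"
  shows "f ` edges G = (\<Union>v\<in>verts G. f ` incident_edges G v)"
  by (subst Union_incident_edges[OF assms]) (rule image_UN)

section \<open>The block coloring of a composition\<close>

text \<open>Each edge of \<open>G\<close> of colour \<open>k\<close> gives a complete bipartite graph, coloured by \<open>Q\<close> in the
  \<open>k\<close>-th block of \<open>m\<close> colours; the copy of \<open>H\<close> at \<open>u\<close> is put directly above the last block
  used at \<open>u\<close>. Both parts are shifted by the same amount \<open>d x\<close> at the vertices \<open>(u, x)\<close>, so that
  they fit together.\<close>

lemma interval_t_coloring_composition:
  fixes G :: "'a ugraph" and H :: "'b ugraph" and p Q :: "'b set \<Rightarrow> int" and d :: "'b \<Rightarrow> int"
  assumes G: "simple_graph G" and H: "simple_graph H"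
    and col: "interval_t_coloring G t f" and im: "f ` edges G = {0..<int t}" and t: "0 < t"
    and pim: "p ` edges H = {0..<int s}" and s: "0 < s"
    and pinj: "\<And>x. x \<in> verts H \<Longrightarrow> inj_on p (incident_edges H x)"
    and pinc: "\<And>x. x \<in> verts H \<Longrightarrow> p ` incident_edges H x = {d x..<d x + int r}"
    and Q: "\<And>x. x \<in> verts H \<Longrightarrow> bij_betw (\<lambda>y. Q {x, y}) (verts H) {d x..<d x + int m}"
  shows "\<exists>F. interval_t_coloring (composition G H) (m * t + s) F"
proof -
  \<comment> \<open>Half-open spectra include isolated vertices, with \<open>a = T = 0\<close>; the
    copy of \<open>H\<close> over such a vertex is then colored by \<open>p\<close> itself.\<close>
  have "\<exists>T a. f ` incident_edges G u = {a..<T} \<and> 0 \<le> a \<and> a \<le> T \<and> T \<le> int t"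
    if u: "u \<in> verts G" for u
  proof (cases "incident_edges G u = {}")
    case True
    then show ?thesis by (intro exI[of _ 0]) auto
  next
    case False
    obtain a b where ab: "f ` incident_edges G u = {a..b}"
      using col u unfolding interval_t_coloring_def integer_interval_def by blast
    have "a \<le> b" using ab False by (metis atLeastatMost_empty_iff image_is_empty)
    moreover have "{a..b} \<subseteq> {0..<int t}"
      unfolding ab[symmetric] im[symmetric] by (auto simp: incident_edges_def)
    ultimately show ?thesis
      using ab by (intro exI[of _ "b + 1"] exI[of _ a]) auto
  qed
  then obtain T a where T: "\<And>u. u \<in> verts G \<Longrightarrow>
      f ` incident_edges G u = {a u..<T u} \<and> 0 \<le> a u \<and> a u \<le> T u \<and> T u \<le> int t"
    by metis
  \<comment> \<open>The image of an edge under \<open>fst\<close> is a singleton exactly for edges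
    inside one copy of \<open>H\<close>. The image under \<open>snd\<close> forgets which end lies
    in which copy, so \<open>Q\<close> has to be symmetric; it is a singleton for an edge joining
    \<open>(u, x)\<close> to \<open>(v, x)\<close>.\<close>
  define F where "F e = (if \<exists>u. fst ` e = {u} then int m * T (the_elem (fst ` e)) + p (snd ` e)
      else int m * f (fst ` e) + Q (snd ` e))" for e
  have Fin: "F {(u, x), (u, y)} = int m * T u + p {x, y}" for u x y
    by (simp add: F_def)
  have Fout: "F {(u, x), (v, y)} = int m * f {u, v} + Q {x, y}" if "{u, v} \<in> edges G" for u v x y
    using that not_loop[OF G] by (auto simp: F_def)
  let ?C = "composition G H"
  have fnb: "f ` incident_edges G u = (\<lambda>v. f {u, v}) ` {v. {u, v} \<in> edges G}" for u
    by (simp add: incident_edges_eq_neighbours[OF G] image_image)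
  have pnb: "p ` incident_edges H x = (\<lambda>y. p {x, y}) ` {y. {x, y} \<in> edges H}" for x
    by (simp add: incident_edges_eq_neighbours[OF H] image_image)
  have finj: "v = v'" if "f {u, v} = f {u, v'}" "{u, v} \<in> edges G" "{u, v'} \<in> edges G" for u v v'
  proof -
    have "inj_on f (incident_edges G u)"
      using col by (simp add: interval_t_coloring_def proper_edge_coloring_iff_inj_on)
    then have "{u, v} = {u, v'}"
      using that by (auto simp: incident_edges_def inj_on_def)
    then show ?thesis by (auto simp: doubleton_eq_iff)
  qed
  have Qim: "(\<lambda>y. Q {x, y}) ` verts H = {d x..<d x + int m}" if "x \<in> verts H" for x
    using Q[OF that] by (simp add: bij_betw_def)
  have Qrange: "Q {x, y} \<in> {d x..<d x + int m}" if "x \<in> verts H" "y \<in> verts H" for x y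
    using Qim that by blast
  have m: "0 < m" if "x \<in> verts H" for x
    using Qrange[OF that that] by auto
  have out: "F ` (\<lambda>(v, y). {(u, x), (v, y)}) ` ({v. {u, v} \<in> edges G} \<times> verts H)
      = {int m * a u + d x..<int m * T u + d x}" if u: "u \<in> verts G" and x: "x \<in> verts H" for u x
  proof -
    have "F ` (\<lambda>(v, y). {(u, x), (v, y)}) ` ({v. {u, v} \<in> edges G} \<times> verts H)
      = (\<lambda>(v, y). int m * f {u, v} + Q {x, y}) ` ({v. {u, v} \<in> edges G} \<times> verts H)"
      unfolding image_image by (intro image_cong) (auto simp: Fout)
    also have "\<dots> = (\<lambda>(k, z). int m * k + z) `
        (((\<lambda>v. f {u, v}) ` {v. {u, v} \<in> edges G}) \<times> ((\<lambda>y. Q {x, y}) ` verts H))"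
      by force
    also have "\<dots> = (\<lambda>(k, z). int m * k + z) ` ({a u..<T u} \<times> {d x..<d x + int m})"
      using T[OF u] Qim[OF x] fnb by simp
    also have "\<dots> = {int m * a u + d x..<int m * T u + d x}"
      using m[OF x] by (intro block_image) simp
    finally show ?thesis .
  qed
  have inn: "F ` (\<lambda>y. {(u, x), (u, y)}) ` {y. {x, y} \<in> edges H}
      = {int m * T u + d x..<int m * T u + d x + int r}" if x: "x \<in> verts H" for u x
  proof -
    have "F ` (\<lambda>y. {(u, x), (u, y)}) ` {y. {x, y} \<in> edges H}
        = (+) (int m * T u) ` (p ` incident_edges H x)"
      unfolding image_image pnb by (intro image_cong) (auto simp: Fin)
    then show ?thesis
      using pinc[OF x] by (simp add: ac_simps)
  qed
  \<comment> \<open>The cross edges stop just below \<open>int m * T u + d x\<close>, where the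
    edges inside the copy begin; at an isolated \<open>u\<close> the first run is empty.\<close>
  have inc: "F ` incident_edges ?C (u, x) = {int m * a u + d x..<int m * T u + d x + int r}"
    if u: "u \<in> verts G" and x: "x \<in> verts H" for u x
  proof -
    have "int m * a u \<le> int m * T u"
      using T[OF u] by (intro mult_left_mono) auto
    then show ?thesis
      unfolding incident_edges_composition[OF G H u x] image_Un out[OF u x] inn[OF x]
      by (intro ivl_disj_un) auto
  qed
  have "inj_on F (incident_edges ?C (u, x))" if u: "u \<in> verts G" and x: "x \<in> verts H" for u x
    unfolding incident_edges_composition[OF G H u x] inj_on_Un
  proof (intro conjI)
    show "inj_on F ((\<lambda>(v, y). {(u, x), (v, y)}) ` ({v. {u, v} \<in> edges G} \<times> verts H))"
    proof (rule inj_onI, clarsimp)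
      fix v y v' y'
      assume *: "{u, v} \<in> edges G" "y \<in> verts H" "{u, v'} \<in> edges G" "y' \<in> verts H"
        and "F {(u, x), (v, y)} = F {(u, x), (v', y')}"
      then have "int m * f {u, v} + Q {x, y} = int m * f {u, v'} + Q {x, y'}"
        by (simp add: Fout)
      then have "f {u, v} = f {u, v'} \<and> Q {x, y} = Q {x, y'}"
        using block_unique Qrange x * by metis
      moreover have "inj_on (\<lambda>y. Q {x, y}) (verts H)"
        using Q[OF x] by (simp add: bij_betw_def)
      ultimately have "v = v'" "y = y'"
        using finj * by (auto dest: inj_onD)
      then show "{(u, x), (v, y)} = {(u, x), (v', y')}" by simp
    qed
    show "inj_on F ((\<lambda>y. {(u, x), (u, y)}) ` {y. {x, y} \<in> edges H})"
    proof (rule inj_onI, clarsimp)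
      fix y y'
      assume *: "{x, y} \<in> edges H" "{x, y'} \<in> edges H"
        and "F {(u, x), (u, y)} = F {(u, x), (u, y')}"
      then have "p {x, y} = p {x, y'}" by (simp add: Fin)
      then have "{x, y} = {x, y'}"
        using pinj[OF x] * by (auto simp: inj_on_def incident_edges_def)
      then show "{(u, x), (u, y)} = {(u, x), (u, y')}" by (auto simp: doubleton_eq_iff)
    qed
    \<comment> \<open>The two kinds of edges have disjoint color ranges, which is more than
      \<open>inj_on_Un\<close> asks for.\<close>
    have disj: "F ` (A - B) \<inter> F ` (B - A) = {}" if "F ` A \<inter> F ` B = {}" for A B
      using that by blast
    have "F ` (\<lambda>(v, y). {(u, x), (v, y)}) ` ({v. {u, v} \<in> edges G} \<times> verts H) \<inter>
          F ` (\<lambda>y. {(u, x), (u, y)}) ` {y. {x, y} \<in> edges H} = {}"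
      unfolding out[OF u x] inn[OF x] by auto
    then show "F ` ((\<lambda>(v, y). {(u, x), (v, y)}) ` ({v. {u, v} \<in> edges G} \<times> verts H) -
          (\<lambda>y. {(u, x), (u, y)}) ` {y. {x, y} \<in> edges H}) \<inter>
        F ` ((\<lambda>y. {(u, x), (u, y)}) ` {y. {x, y} \<in> edges H} -
          (\<lambda>(v, y). {(u, x), (v, y)}) ` ({v. {u, v} \<in> edges G} \<times> verts H)) = {}"
      by (rule disj)
  qed
  \<comment> \<open>The characterization of proper colorings ranges over all points of the type, so
    non-vertices have to be covered as well.\<close>
  moreover have "incident_edges ?C w = {}" if "w \<notin> verts G \<times> verts H" for w
    using that by (auto simp: incident_edges_def composition_def)
  ultimately have proper: "proper_edge_coloring ?C F"
    unfolding proper_edge_coloring_iff_inj_on by (metis inj_on_empty mem_Sigma_iff surj_pair)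
  have Cim: "F ` edges ?C = (\<Union>u\<in>verts G. \<Union>x\<in>verts H.
      {int m * a u + d x..<int m * T u + d x + int r})"
  proof -
    have "F ` edges ?C = (\<Union>w\<in>verts ?C. F ` incident_edges ?C w)"
      by (rule image_edges[OF simple_graph_composition[OF G H]])
    also have "\<dots> = (\<Union>u\<in>verts G. \<Union>x\<in>verts H. F ` incident_edges ?C (u, x))"
      by (auto simp: composition_def)
    finally show ?thesis using inc by auto
  qed
  \<comment> \<open>A vertex \<open>x0\<close> on an edge of \<open>p\<close>-color 0 has
    \<open>d x0 = 0\<close>: the blocks at \<open>(u, x0)\<close> are unshifted, which is what
    reaches the lowest colors.\<close>
  have "0 \<in> p ` edges H" using pim s by simp
  then obtain x0 where x0: "x0 \<in> verts H" "0 \<in> p ` incident_edges H x0"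
    unfolding image_edges[OF H] by blast
  have r: "0 < r" using x0 pinc by fastforce
  have sub: "{d x..<d x + int r} \<subseteq> {0..<int s}" if "x \<in> verts H" for x
    unfolding pinc[OF that, symmetric] pim[symmetric] by (auto simp: incident_edges_def)
  have d: "0 \<le> d x" "d x + int r \<le> int s" if "x \<in> verts H" for x
    using sub[OF that] r by auto
  have d0: "d x0 = 0" using x0 pinc d(1)[OF x0(1)] by auto
  have up: "F ` edges ?C \<subseteq> {0..<int (m * t + s)}"
  proof
    fix c assume "c \<in> F ` edges ?C"
    then obtain u x where ux: "u \<in> verts G" "x \<in> verts H"
      "c \<in> {int m * a u + d x..<int m * T u + d x + int r}"
      unfolding Cim by blast
    have "0 \<le> int m * a u" "int m * T u \<le> int m * int t"
      using T[OF ux(1)] by (auto intro: mult_left_mono)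
    then show "c \<in> {0..<int (m * t + s)}"
      using d[OF ux(2)] ux(3) by simp
  qed
  \<comment> \<open>Colors below \<open>m * t\<close> lie in an unshifted block and occur at some
    \<open>(u, x0)\<close>. The remaining \<open>s\<close> colors are those of the copy of
    \<open>H\<close> over an endpoint \<open>u\<close> of an edge with the top color
    \<open>t - 1\<close>, because there \<open>T u = t\<close>.\<close>
  have low: "c \<in> F ` edges ?C" if c: "c \<in> {0..<int (m * t + s)}" for c
  proof (cases "c < int m * int t")
    case True
    have "c \<in> (\<lambda>(k, z). int m * k + z) ` ({0..<int t} \<times> {0..<0 + int m})"
      using True c m[OF x0(1)] by (subst block_image) auto
    then obtain k z where k: "k \<in> f ` edges G" "0 \<le> z" "z < int m" "c = int m * k + z"
      using im by auto
    then obtain u where u: "u \<in> verts G" "k \<in> f ` incident_edges G u"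
      unfolding image_edges[OF G] by blast
    then have "c \<in> (\<lambda>(k, z). int m * k + z) ` ({a u..<T u} \<times> {d x0..<d x0 + int m})"
      using T[OF u(1)] d0 k by auto
    then have "c \<in> {int m * a u + d x0..<int m * T u + d x0}"
      using m[OF x0(1)] by (subst (asm) block_image) auto
    then have "c \<in> {int m * a u + d x0..<int m * T u + d x0 + int r}" by auto
    then show ?thesis unfolding Cim using u x0 by blast
  next
    case False
    have "int t - 1 \<in> f ` edges G" using im t by auto
    then obtain u where u: "u \<in> verts G" "int t - 1 \<in> f ` incident_edges G u"
      unfolding image_edges[OF G] by blast
    then have Tu: "T u = int t" using T[OF u(1)] by auto
    have "c - int m * int t \<in> p ` edges H"
      using False c pim by auto
    then obtain x where x: "x \<in> verts H" "c - int m * int t \<in> p ` incident_edges H x"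
      unfolding image_edges[OF H] by blast
    have "int m * a u \<le> int m * T u"
      using T[OF u(1)] by (intro mult_left_mono) auto
    then have "c \<in> {int m * a u + d x..<int m * T u + d x + int r}"
      using x pinc[OF x(1)] Tu by auto
    then show ?thesis unfolding Cim using u x by blast
  qed
  have "\<forall>w\<in>verts ?C. integer_interval (F ` incident_edges ?C w)"
  proof
    fix w assume "w \<in> verts ?C"
    then obtain u x where ux: "w = (u, x)" "u \<in> verts G" "x \<in> verts H"
      by (auto simp: composition_def)
    have "{b..<c} = {b..c - 1}" for b c :: int by auto
    then show "integer_interval (F ` incident_edges ?C w)"
      unfolding integer_interval_def ux(1) inc[OF ux(2,3)] by blast
  qed
  moreover have "F ` edges ?C = {0..<0 + int (m * t + s)}"
    using up low by auto
  ultimately show ?thesis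
    using proper unfolding interval_t_coloring_def by blast
qed

section \<open>Specialization to cycles\<close>

text \<open>An injection into a finite set of the same size is onto, so only injectivity and range
  of the rows of \<open>Q\<close> have to be checked.\<close>

lemma bij_betw_atLeastLessThan_int:
  fixes g :: "nat \<Rightarrow> int"
  assumes "inj_on g {0..<m}" "g ` {0..<m} \<subseteq> {c..<c + int m}"
  shows "bij_betw g {0..<m} {c..<c + int m}"
  using assms by (simp add: bij_betw_def card_image card_subset_eq)

lemma verts_cycle_graph [simp]: "verts (cycle_graph m) = {0..<m}"
  by (simp add: cycle_graph_def)

text \<open>Case distinctions replace \<open>mod\<close>, so that concrete colorings can be verified
  by splitting and linear arithmetic.\<close>

lemma incident_edges_cycle_graph:
  assumes "2 \<le> m" "x < m"
  shows "incident_edges (cycle_graph m) x =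
    {{x, (if x = m - 1 then 0 else x + 1)}, {x, (if x = 0 then m - 1 else x - 1)}}"
proof -
  have s: "(i + 1) mod m = (if i = m - 1 then 0 else i + 1)" if "i < m" for i
    using that by auto
  have E: "edges (cycle_graph m) = {{i, (if i = m - 1 then 0 else i + 1)} | i. i < m}"
    unfolding cycle_graph_def ugraph.sel
    by (intro Collect_cong iff_exI rev_conj_cong refl) (simp only: s)
  show ?thesis
  proof (intro equalityI subsetI)
    fix e assume "e \<in> incident_edges (cycle_graph m) x"
    then obtain i where i: "i < m" "e = {i, (if i = m - 1 then 0 else i + 1)}" "x \<in> e"
      unfolding incident_edges_def E by blast
    show "e \<in> {{x, (if x = m - 1 then 0 else x + 1)}, {x, (if x = 0 then m - 1 else x - 1)}}"
    proof (cases "i = x")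
      case False
      then have "x = (if i = m - 1 then 0 else i + 1)" using i by simp
      then have "i = (if x = 0 then m - 1 else x - 1)" using i by (auto split: if_splits)
      with \<open>x = _\<close> i show ?thesis by (auto simp: insert_commute)
    qed (use i in simp)
  next
    fix e assume "e \<in> {{x, (if x = m - 1 then 0 else x + 1)}, {x, (if x = 0 then m - 1 else x - 1)}}"
    then consider "e = {x, (if x = m - 1 then 0 else x + 1)}"
      | "e = {x, (if x = 0 then m - 1 else x - 1)}" by blast
    then show "e \<in> incident_edges (cycle_graph m) x"
    proof cases
      case 1
      then show ?thesis using assms unfolding incident_edges_def E by blast
    next
      case 2
      \<comment> \<open>The predecessor of \<open>x\<close> on the cycle, which is the index under
        which this edge is listed in \<open>E\<close>.\<close>
      define j where "j = (if x = 0 then m - 1 else x - 1)"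
      have x: "(if j = m - 1 then 0 else j + 1) = x" and "j < m"
        using assms by (auto simp: j_def)
      have "e = {j, (if j = m - 1 then 0 else j + 1)}"
        unfolding x using 2 by (simp add: j_def insert_commute)
      then show ?thesis using 2 \<open>j < m\<close> unfolding incident_edges_def E by blast
    qed
  qed
qed

text \<open>The block coloring with \<open>r = 2\<close>, its hypotheses reduced to arithmetic on
  vertex numbers.\<close>

lemma interval_t_coloring_composition_cycle:
  fixes G :: "'a ugraph" and p Q :: "nat set \<Rightarrow> int" and d :: "nat \<Rightarrow> int"
  assumes G: "simple_graph G" and m: "2 \<le> m"
    and t: "t \<in> interval_color_numbers G" and s: "0 < s"
    and p: "\<And>x. x < m \<Longrightarrow> {p {x, (if x = m - 1 then 0 else x + 1)},
      p {x, (if x = 0 then m - 1 else x - 1)}} = {d x, d x + 1}"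
    and d: "(\<Union>x<m. {d x, d x + 1}) = {0..<int s}"
    and inj: "\<And>x. x < m \<Longrightarrow> inj_on (\<lambda>y. Q {x, y}) {0..<m}"
    and ran: "\<And>x y. x < m \<Longrightarrow> y < m \<Longrightarrow> Q {x, y} \<in> {d x..<d x + int m}"
  shows "m * t + s \<in> interval_color_numbers (composition G (cycle_graph m))"
proof -
  obtain f where f: "interval_t_coloring G t f" "f ` edges G = {0..<int t}" and "0 < t"
    using t interval_t_coloring_shift unfolding interval_color_numbers_def by blast
  let ?H = "cycle_graph m"
  have H: "simple_graph ?H" using m by (rule simple_graph_cycle_graph)
  have inc: "p ` incident_edges ?H x = {d x, d x + 1}" if "x < m" for x
    using p[OF that] incident_edges_cycle_graph[OF m that] by auto
  have "\<exists>F. interval_t_coloring (composition G ?H) (m * t + s) F"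
  proof (rule interval_t_coloring_composition[OF G H f \<open>0 < t\<close> _ s, where r = 2])
    show "p ` edges ?H = {0..<int s}"
      unfolding image_edges[OF H] using inc d by (auto simp: lessThan_atLeast0)
  next
    fix x assume "x \<in> verts ?H"
    then have x: "x < m" by simp
    show "p ` incident_edges ?H x = {d x..<d x + int 2}"
      using inc[OF x] by auto
    have inj2: "inj_on p {A, B}" if "p A \<noteq> p B" for A B
      using that by auto
    \<comment> \<open>Two colors that together make up the set of \<open>d x\<close> and
      \<open>d x + 1\<close> must differ, so properness at \<open>x\<close> comes with the
      spectrum.\<close>
    have "p {x, (if x = m - 1 then 0 else x + 1)} \<noteq> p {x, (if x = 0 then m - 1 else x - 1)}"
      using p[OF x] by (metis add_cancel_right_right doubleton_eq_iff zero_neq_one)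
    then show "inj_on p (incident_edges ?H x)"
      unfolding incident_edges_cycle_graph[OF m x] by (rule inj2)
    show "bij_betw (\<lambda>y. Q {x, y}) (verts ?H) {d x..<d x + int m}"
      using inj[OF x] ran[OF x] by (auto intro!: bij_betw_atLeastLessThan_int)
  qed
  with \<open>0 < t\<close> m show ?thesis by (auto simp: interval_color_numbers_def)
qed

section \<open>The two colorings of the cycle\<close>

text \<open>\<open>p\<close> is 0 on the edges \<open>{2 * k, 2 * k + 1}\<close> and 1 on the
  others; even length makes the alternation close up. Every vertex sees both colors, hence
  \<open>d = 0\<close>, and \<open>Q\<close> is the addition table modulo
  \<open>2 * n\<close>.\<close>

lemma short_coloring_composition_cycle:
  assumes G: "simple_graph G" and n: "2 \<le> n" and t: "t \<in> interval_color_numbers G"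
  shows "2 * n * t + 2 \<in> interval_color_numbers (composition G (cycle_graph (2 * n)))"
proof (rule interval_t_coloring_composition_cycle[OF G _ t, where d = "\<lambda>_. 0"
    and p = "\<lambda>S. if Min S div 2 = Max S div 2 then 0 else 1"
    and Q = "\<lambda>S. int (Min S + Max S) mod int (2 * n)"])
  \<comment> \<open>\<open>Min S + Max S\<close> expresses \<open>x + y\<close> through the
    unordered pair and gives \<open>2 * x\<close> on a singleton, as the diagonal of the table
    requires.\<close>
  have minmax: "Min {x, y} + Max {x, y} = x + y" for x y :: nat
    by (simp add: min_def max_def)
  fix x assume x: "x < 2 * n"
  show "inj_on (\<lambda>y. int (Min {x, y} + Max {x, y}) mod int (2 * n)) {0..<2 * n}"
  proof (rule inj_onI)
    fix y z assume yz: "y \<in> {0..<2 * n}" "z \<in> {0..<2 * n}"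
      "int (Min {x, y} + Max {x, y}) mod int (2 * n) = int (Min {x, z} + Max {x, z}) mod int (2 * n)"
    have "(x + y) mod (2 * n) = (x + z) mod (2 * n)"
      using yz(3) by (simp only: minmax of_nat_mod[symmetric] of_nat_eq_iff)
    then have "y mod (2 * n) = z mod (2 * n)"
      unfolding nat_mod_eq_iff by (metis (no_types, lifting) add.assoc add_left_cancel)
    then show "y = z" using yz by simp
  qed
  show "{if Min {x, if x = 2 * n - 1 then 0 else x + 1} div 2 =
           Max {x, if x = 2 * n - 1 then 0 else x + 1} div 2 then 0 else 1,
         if Min {x, if x = 0 then 2 * n - 1 else x - 1} div 2 =
           Max {x, if x = 0 then 2 * n - 1 else x - 1} div 2 then 0 else 1} = {0, 0 + 1 :: int}"
  \<comment> \<open>An even \<open>x\<close> has color 0 towards its successor and 1 towards its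
    predecessor; for an odd \<open>x\<close> it is the reverse. Only odd \<open>x\<close> can wrap
    around at \<open>2 * n - 1\<close>, and only even \<open>x\<close> at 0.\<close>
  proof (cases "even x")
    case True
    then obtain k where k: "x = 2 * k" by blast
    moreover have "x \<noteq> 2 * n - 1" using k n by presburger
    ultimately show ?thesis using x n by (cases k) (auto simp: min_def max_def)
  next
    case False
    then obtain k where "x = 2 * k + 1" by (blast elim: oddE)
    then show ?thesis using x n by (auto simp: min_def max_def)
  qed
next
  have "0 \<in> {..<2 * n}" "{0, 0 + 1} = {0..<int 2}"
    using n by auto
  then show "(\<Union>x<2 * n. {0, 0 + 1}) = {0..<int 2}" by blast
qed (use n in auto)

text \<open>The cycle is coloured upwards from \<open>0\<close> to \<open>n\<close> along both of its halves, so \<open>d\<close> is the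
  distance to the edge \<open>{0, 2n - 1}\<close>. Between two cycles, \<open>d x + d y\<close> alone would use
  each colour twice at a vertex; adding \<open>n\<close> when \<open>x\<close> and \<open>y\<close> lie in different halves separates the two.\<close>

lemma long_coloring_composition_cycle:
  assumes G: "simple_graph G" and n: "2 \<le> n" and t: "t \<in> interval_color_numbers G"
  shows "2 * n * t + (n + 1) \<in> interval_color_numbers (composition G (cycle_graph (2 * n)))"
proof -
  define d where "d x = min (int x) (2 * int n - 1 - int x)" for x :: nat
  \<comment> \<open>The edge from \<open>i - 1\<close> to \<open>i\<close> has color
    \<open>min i (2 * n - i)\<close>, read off from its larger end. The closing edge is set apart,
    since this formula would give it 1 instead of 0.\<close>
  define p where "p S = (if S = {0, 2 * n - 1} then 0 else min (int (Max S)) (2 * int n - int (Max S)))"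
    for S :: "nat set"
  define Q where "Q S = d (Min S) + d (Max S) + (if Min S < n \<and> n \<le> Max S then int n else 0)"
    for S :: "nat set"
  have Q: "Q {x, y} = d x + d y + (if (x < n) = (y < n) then 0 else int n)" for x y
    by (auto simp: Q_def min_def max_def)
  show ?thesis
  proof (rule interval_t_coloring_composition_cycle[OF G _ t, where d = d and p = p and Q = Q])
    fix x assume x: "x < 2 * n"
    \<comment> \<open>On each half \<open>d\<close> takes every value in \<open>0..<n\<close> once.
      So the half containing \<open>x\<close> fills the \<open>n\<close> colors from
      \<open>d x\<close> on, and the other half the \<open>n\<close> colors after those.\<close>
    show "inj_on (\<lambda>y. Q {x, y}) {0..<2 * n}"
      using n x by (intro inj_onI) (auto simp: Q d_def min_def split: if_splits)
    show "{p {x, if x = 2 * n - 1 then 0 else x + 1}, p {x, if x = 0 then 2 * n - 1 else x - 1}}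
        = {d x, d x + 1}"
      using n x by (auto simp: p_def d_def min_def max_def doubleton_eq_iff)
    fix y assume "y < 2 * n"
    then show "Q {x, y} \<in> {d x..<d x + int (2 * n)}"
      using n x by (auto simp: Q d_def min_def)
  next
    show "(\<Union>x<2 * n. {d x, d x + 1}) = {0..<int (n + 1)}"
    proof (intro equalityI subsetI)
      fix c assume c: "c \<in> {0..<int (n + 1)}"
      show "c \<in> (\<Union>x<2 * n. {d x, d x + 1})"
      \<comment> \<open>Each color below \<open>n\<close> is \<open>d\<close> of the vertex with
        that number; the top color \<open>n\<close> arises only as \<open>d x + 1\<close>, on the
        middle edge between \<open>n - 1\<close> and \<open>n\<close>.\<close>
      proof (cases "c = int n")
        case True
        then show ?thesis using n by (intro UN_I[of "n - 1"]) (auto simp: d_def)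
      next
        case False
        then show ?thesis using c n by (intro UN_I[of "nat c"]) (auto simp: d_def)
      qed
    qed (auto simp: d_def)
  qed (use n in auto)
qed

theorem theorem8:
  fixes G :: "'a ugraph"
  assumes "simple_graph G"
    and "interval_colorable G"
  shows "\<forall>n\<ge>2. interval_colorable (composition G (cycle_graph (2 * n)))
    \<and> w_min (composition G (cycle_graph (2 * n))) \<le> 2 * (w_min G * n + 1)
    \<and> W_max (composition G (cycle_graph (2 * n))) \<ge> (2 * W_max G + 1) * n + 1"
proof (intro allI impI)
  fix n :: nat assume n: "2 \<le> n"
  let ?C = "composition G (cycle_graph (2 * n))"
  have "simple_graph ?C"
    using n assms(1) by (intro simple_graph_composition simple_graph_cycle_graph) auto
  then have fin: "finite (interval_color_numbers ?C)"
    by (rule finite_interval_color_numbers)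
  \<comment> \<open>Finiteness and nonemptiness ensure that the extreme values are attained by
    actual colorings of \<open>G\<close>.\<close>
  have "w_min G \<in> interval_color_numbers G" "W_max G \<in> interval_color_numbers G"
    using assms finite_interval_color_numbers[OF assms(1)]
    by (simp_all add: w_min_def W_max_def interval_colorable_def)
  then have short: "2 * n * w_min G + 2 \<in> interval_color_numbers ?C"
    and long: "2 * n * W_max G + (n + 1) \<in> interval_color_numbers ?C"
    using short_coloring_composition_cycle[OF assms(1) n]
      long_coloring_composition_cycle[OF assms(1) n] by blast+
  have "w_min ?C \<le> 2 * n * w_min G + 2" "2 * n * W_max G + (n + 1) \<le> W_max ?C"
    unfolding w_min_def[of ?C] W_max_def[of ?C] using fin short long by simp_all
  then show "interval_colorable ?C \<and> w_min ?C \<le> 2 * (w_min G * n + 1)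
      \<and> W_max ?C \<ge> (2 * W_max G + 1) * n + 1"
    using short by (auto simp: interval_colorable_def algebra_simps)
qed

end
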